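(* Let $\mathscr{C}$ be a class of sets of tgds with $\mathscr{C}\subseteq\mathsf{CT}^{\mathsf{std}}_{\forall\forall}$ such that $\mathscr{C}$ is closed under semi-enrichment. Then $\mathscr{C}\subseteq\mathsf{CT}^{\mathsf{sobl}}_{\forall\forall}$.
   Context: Let $\mathsf{Cons}$ (constants), $\mathsf{Nulls}$ (nulls) and $\mathsf{Vars}$ (variables) be pairwise disjoint countably infinite sets. A schema is a finite set of relation symbols with arities. An instance is a finite set of atoms $R(a_1,\dots,a_k)$ with $a_i\in\mathsf{Cons}\cup\mathsf{Nulls}$. A tgd $\xi=\alpha\to\beta$ is a sentence $\forall\bar x,\bar y\,(\alpha(\bar x,\bar y)\to\exists\bar z\,\beta(\bar x,\bar z))$, with body $\alpha$ and head $\beta$ conjunctions of relational atoms over variables and constants; $\bar x$ are the universal variables occurring in both body and head, $\bar y$ those occurring only in the body. Sets of tgds are finite. A trigger for $\Sigma$ on $I$ is a pair $(\xi,h)$ with $\xi=\alpha\to\beta\in\Sigma$ and $h$ a mapping of the universal variables of $\xi$ to $\mathsf{Cons}\cup\mathsf{Nulls}$ (identity on constants) with $h(\alpha)\subseteq I$. It is active on $I$ if no extension $h'$ of $h$ satisfies $h'(\beta)\subseteq I$. Firing it transforms $I$ into $J=I\cup h'(\beta)$, where $h'$ extends $h$ by assigning new fresh nulls to the existential variables. A chase sequence from $I_0=I$ with $\Sigma$ is a finite or infinite sequence $I_0,I_1,\dots$ in which each $I_{i+1}$ is obtained from $I_i$ by firing an applicable trigger. It terminates if some $I_i$ has no applicable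 trigger left. In the standard chase ($\mathsf{std}$) the applicable triggers are those active on the current instance. In the semi-oblivious chase ($\mathsf{sobl}$), triggers $(\xi,h)$ and $(\xi,g)$ are equivalent if $h(\bar x)=g(\bar x)$; the applicable triggers are all triggers (active or not) on the current instance whose equivalence class contains no trigger already fired in the sequence, so that exactly one trigger from each class is fired. All chase sequences are assumed fair: in an infinite sequence, a trigger applicable at some step is, at some later step, fired or no longer applicable. For $\star\in\{\mathsf{std},\mathsf{sobl}\}$, $\mathsf{CT}^\star_{\forall\forall}$ is the class of all sets $\Sigma$ of tgds such that for every instance $I$ all $\star$-chase sequences with $\Sigma$ on $I$ terminate. Semi-enrichment: for a tgd $\xi=\alpha(\bar x,\bar y)\to\exists\bar z\,\beta(\bar x,\bar z)$ over a schema $\mathbf R$, let $\tilde\xi=\alpha(\bar x,\bar y)\to\exists\bar z\,\beta(\bar x,\bar z),H(\bar x)$, where $H$ is a new relation symbol not in $\mathbf R$ (a separate one for each tgd), and $\widetilde\Sigma=\{\tilde\xi:\xi\in\Sigma\}$. A class $\mathscr{C}$ of sets of tgds is closed under semi-enrichment if $\Sigma\in\mathscr{C}$ implies $\widetilde\Sigma\in\mathscr{C}$. *)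

theory Defs
  imports Main "HOL-Library.FuncSet" "HOL-Library.Extended_Nat"
begin

text \<open>Every relation symbol carries its arity, so each arity has infinitely many symbols.\<close>

datatype relsym = Rel nat (arity: nat)

datatype 'a atom = Atom (relsym: relsym) (args: "'a list")

datatype val = Const nat | Null nat

datatype trm = Var nat | Cst nat

definition wf_atom :: "'a atom \<Rightarrow> bool" where
  "wf_atom a \<longleftrightarrow> length (args a) = arity (relsym a)"

type_synonym inst = "val atom set"

definition is_instance :: "inst \<Rightarrow> bool" where
  "is_instance I \<longleftrightarrow> finite I \<and> (\<forall>a\<in>I. wf_atom a)"

definition adom :: "inst \<Rightarrow> val set" where
  "adom I = (\<Union>a\<in>I. set (args a))"

text \<open>A conjunction is the list of its conjuncts; the empty conjunction is admitted, both as a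
  body and as a head.\<close>

type_synonym conj = "trm atom list"

datatype tgd = Tgd (body: conj) (head: conj)

definition conj_vars :: "conj \<Rightarrow> nat set" where
  "conj_vars \<alpha> = {x. \<exists>a\<in>set \<alpha>. Var x \<in> set (args a)}"

definition universal_vars :: "tgd \<Rightarrow> nat set" where
  "universal_vars \<xi> = conj_vars (body \<xi>)"

definition frontier :: "tgd \<Rightarrow> nat set" where
  "frontier \<xi> = conj_vars (body \<xi>) \<inter> conj_vars (head \<xi>)"

definition existential_vars :: "tgd \<Rightarrow> nat set" where
  "existential_vars \<xi> = conj_vars (head \<xi>) - conj_vars (body \<xi>)"

definition wf_tgd :: "tgd \<Rightarrow> bool" where
  "wf_tgd \<xi> \<longleftrightarrow> (\<forall>a\<in>set (body \<xi>) \<union> set (head \<xi>). wf_atom a)"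

definition tgd_set :: "tgd set \<Rightarrow> bool" where
  "tgd_set \<Sigma> \<longleftrightarrow> finite \<Sigma> \<and> (\<forall>\<xi>\<in>\<Sigma>. wf_tgd \<xi>)"

definition schema_of :: "tgd set \<Rightarrow> relsym set" where
  "schema_of \<Sigma> = (\<Union>\<xi>\<in>\<Sigma>. relsym ` (set (body \<xi>) \<union> set (head \<xi>)))"

fun eval_trm :: "(nat \<Rightarrow> val) \<Rightarrow> trm \<Rightarrow> val" where
  "eval_trm h (Var x) = h x"
| "eval_trm h (Cst c) = Const c"

definition conj_image :: "(nat \<Rightarrow> val) \<Rightarrow> conj \<Rightarrow> inst" where
  "conj_image h \<alpha> = map_atom (eval_trm h) ` set \<alpha>"

type_synonym trigger = "tgd \<times> (nat \<Rightarrow> val)"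

text \<open>The assignment of a trigger is a function on the universal variables only; totality
  of the type is compensated by requiring it to be \<open>undefined\<close> elsewhere.\<close>

definition is_trigger :: "tgd set \<Rightarrow> inst \<Rightarrow> trigger \<Rightarrow> bool" where
  "is_trigger \<Sigma> I = (\<lambda>(\<xi>, h). \<xi> \<in> \<Sigma> \<and> h \<in> extensional (universal_vars \<xi>) \<and>
     conj_image h (body \<xi>) \<subseteq> I)"

definition extends :: "tgd \<Rightarrow> (nat \<Rightarrow> val) \<Rightarrow> (nat \<Rightarrow> val) \<Rightarrow> bool" where
  "extends \<xi> h h' \<longleftrightarrow> (\<forall>x\<in>universal_vars \<xi>. h' x = h x)"

definition active :: "inst \<Rightarrow> trigger \<Rightarrow> bool" where
  "active I = (\<lambda>(\<xi>, h). \<not> (\<exists>h'. extends \<xi> h h' \<and> conj_image h' (head \<xi>) \<subseteq> I))"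

definition fire :: "trigger \<Rightarrow> inst \<Rightarrow> inst \<Rightarrow> bool" where
  "fire = (\<lambda>(\<xi>, h) I J. \<exists>h'. extends \<xi> h h' \<and>
     inj_on h' (existential_vars \<xi>) \<and>
     h' ` existential_vars \<xi> \<subseteq> range Null - adom I \<and>
     J = I \<union> conj_image h' (head \<xi>))"

definition trigger_equiv :: "trigger \<Rightarrow> trigger \<Rightarrow> bool" where
  "trigger_equiv = (\<lambda>(\<xi>, h) (\<zeta>, g). \<xi> = \<zeta> \<and> (\<forall>x\<in>frontier \<xi>. h x = g x))"

datatype chase_variant = Std | Sobl

text \<open>The argument \<open>F\<close> is the set of triggers fired so far; the standard chase ignores it.\<close>

fun applicable :: "chase_variant \<Rightarrow> tgd set \<Rightarrow> inst \<Rightarrow> trigger set \<Rightarrow> trigger \<Rightarrow> bool" where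
  "applicable Std \<Sigma> I F t \<longleftrightarrow> is_trigger \<Sigma> I t \<and> active I t"
| "applicable Sobl \<Sigma> I F t \<longleftrightarrow> is_trigger \<Sigma> I t \<and> (\<forall>s\<in>F. \<not> trigger_equiv t s)"

text \<open>A finite or infinite sequence is given by its number \<open>N\<close> of firing steps, the instances
  \<open>I i\<close> for \<open>i \<le> N\<close>, and the triggers \<open>T i\<close> for \<open>i < N\<close>, where \<open>T i\<close> leads from
  \<open>I i\<close> to \<open>I (Suc i)\<close>. Values beyond these ranges are irrelevant.\<close>

definition applicable_at ::
  "chase_variant \<Rightarrow> tgd set \<Rightarrow> (nat \<Rightarrow> inst) \<Rightarrow> (nat \<Rightarrow> trigger) \<Rightarrow> nat \<Rightarrow> trigger \<Rightarrow> bool" where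
  "applicable_at v \<Sigma> I T i t \<longleftrightarrow> applicable v \<Sigma> (I i) (T ` {..<i}) t"

definition fair ::
  "chase_variant \<Rightarrow> tgd set \<Rightarrow> (nat \<Rightarrow> inst) \<Rightarrow> (nat \<Rightarrow> trigger) \<Rightarrow> bool" where
  "fair v \<Sigma> I T \<longleftrightarrow> (\<forall>i t. applicable_at v \<Sigma> I T i t \<longrightarrow>
     (\<exists>j\<ge>i. T j = t \<or> \<not> applicable_at v \<Sigma> I T j t))"

text \<open>A finite sequence may only stop when no trigger is applicable; otherwise an unfinished
  initial segment would already count as a nonterminating sequence.\<close>

definition chase_sequence ::
  "chase_variant \<Rightarrow> tgd set \<Rightarrow> inst \<Rightarrow> enat \<Rightarrow> (nat \<Rightarrow> inst) \<Rightarrow> (nat \<Rightarrow> trigger) \<Rightarrow> bool" where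
  "chase_sequence v \<Sigma> I0 N I T \<longleftrightarrow>
     I 0 = I0 \<and>
     (\<forall>i. enat i < N \<longrightarrow> applicable_at v \<Sigma> I T i (T i) \<and> fire (T i) (I i) (I (Suc i))) \<and>
     (\<forall>n. N = enat n \<longrightarrow> \<not> (\<exists>t. applicable_at v \<Sigma> I T n t)) \<and>
     (N = \<infinity> \<longrightarrow> fair v \<Sigma> I T)"

definition terminates ::
  "chase_variant \<Rightarrow> tgd set \<Rightarrow> enat \<Rightarrow> (nat \<Rightarrow> inst) \<Rightarrow> (nat \<Rightarrow> trigger) \<Rightarrow> bool" where
  "terminates v \<Sigma> N I T \<longleftrightarrow> (\<exists>i. enat i \<le> N \<and> \<not> (\<exists>t. applicable_at v \<Sigma> I T i t))"

definition CT :: "chase_variant \<Rightarrow> tgd set set" where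
  "CT v = {\<Sigma>. tgd_set \<Sigma> \<and> (\<forall>I0. is_instance I0 \<longrightarrow>
     (\<forall>N I T. chase_sequence v \<Sigma> I0 N I T \<longrightarrow> terminates v \<Sigma> N I T))}"

definition enrich :: "relsym \<Rightarrow> nat list \<Rightarrow> tgd \<Rightarrow> tgd" where
  "enrich H xs \<xi> = Tgd (body \<xi>) (head \<xi> @ [Atom H (map Var xs)])"

text \<open>A semi-enrichment is determined only up to the choice of the new symbols \<open>H\<close> and of the
  enumerations \<open>X\<close> of the frontiers, hence a relation. A class is closed under semi-enrichment
  if it contains some semi-enrichment of each of its members; this makes closure independent of
  any particular choice and is implied by closure under all choices.\<close>

definition semi_enrichment :: "tgd set \<Rightarrow> tgd set \<Rightarrow> bool" where
  "semi_enrichment \<Sigma> \<Sigma>' \<longleftrightarrow> (\<exists>H X.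
     inj_on H \<Sigma> \<and>
     (\<forall>\<xi>\<in>\<Sigma>. distinct (X \<xi>) \<and> set (X \<xi>) = frontier \<xi> \<and>
        H \<xi> \<notin> schema_of \<Sigma> \<and> arity (H \<xi>) = length (X \<xi>)) \<and>
     \<Sigma>' = (\<lambda>\<xi>. enrich (H \<xi>) (X \<xi>) \<xi>) ` \<Sigma>)"

definition closed_under_semi_enrichment :: "tgd set set \<Rightarrow> bool" where
  "closed_under_semi_enrichment \<C> \<longleftrightarrow> (\<forall>\<Sigma>\<in>\<C>. \<exists>\<Sigma>'\<in>\<C>. semi_enrichment \<Sigma> \<Sigma>')"

end

theory Submission imports Defs begin

text \<open>An infinite semi-oblivious chase with \<open>\<Sigma>\<close> is turned, step by step, into an infinite fair
  standard chase with \<open>\<Sigma>'\<close>. The atom \<open>H(h(x))\<close> produced by firing \<open>(\<xi>, h)\<close> records the equivalence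
  class of that trigger: a trigger of an unrecorded class is active because its \<open>H\<close>-atom is missing,
  and a trigger of a recorded class is inactive because the nulls created for its class witness its
  head. Hence standard applicability for \<open>\<Sigma>'\<close> is semi-oblivious applicability for \<open>\<Sigma>\<close>. The start
  instance may already contain \<open>H\<close>-atoms, so it is first restricted to the schema of \<open>\<Sigma>\<close>.\<close>

section \<open>Effect of enrichment on a single tgd\<close>

lemma body_enrich [simp]: "body (enrich H xs \<xi>) = body \<xi>"
  by (simp add: enrich_def)

lemma universal_vars_enrich [simp]: "universal_vars (enrich H xs \<xi>) = universal_vars \<xi>"
  by (simp add: universal_vars_def)

lemma extends_enrich [simp]: "extends (enrich H xs \<xi>) = extends \<xi>"
  by (simp add: extends_def fun_eq_iff)

lemma existential_vars_enrich:
  assumes "set xs \<subseteq> universal_vars \<xi>"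
  shows "existential_vars (enrich H xs \<xi>) = existential_vars \<xi>"
  using assms by (auto simp: existential_vars_def universal_vars_def enrich_def conj_vars_def)

lemma conj_image_head_enrich:
  "conj_image h (head (enrich H xs \<xi>)) = insert (Atom H (map h xs)) (conj_image h (head \<xi>))"
  by (simp add: conj_image_def enrich_def comp_def)

lemma frontier_subset_universal_vars: "frontier \<xi> \<subseteq> universal_vars \<xi>"
  by (simp add: frontier_def universal_vars_def)

section \<open>Conjunction images and activity\<close>

lemma eval_trm_cong:
  assumes "\<And>x. t = Var x \<Longrightarrow> h x = g x"
  shows "eval_trm h t = eval_trm g t"
  using assms by (cases t) auto

lemma conj_image_cong:
  assumes "\<And>x. x \<in> conj_vars \<alpha> \<Longrightarrow> h x = g x"
  shows "conj_image h \<alpha> = conj_image g \<alpha>"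
proof -
  have "map_atom (eval_trm h) a = map_atom (eval_trm g) a" if "a \<in> set \<alpha>" for a
    using that assms
    by (intro atom.map_cong0 eval_trm_cong) (cases a; auto simp: conj_vars_def; force)
  then show ?thesis
    by (simp add: conj_image_def)
qed

lemma image_conj_vars_subset_adom:
  assumes "conj_image h \<alpha> \<subseteq> I"
  shows "h ` conj_vars \<alpha> \<subseteq> adom I"
proof
  fix v assume "v \<in> h ` conj_vars \<alpha>"
  then obtain x a where x: "v = h x" "a \<in> set \<alpha>" "Var x \<in> set (args a)"
    by (auto simp: conj_vars_def)
  have "map_atom (eval_trm h) a \<in> I"
    using assms x by (auto simp: conj_image_def)
  moreover have "v \<in> set (args (map_atom (eval_trm h) a))"
    using x by (cases a) force
  ultimately show "v \<in> adom I"
    by (auto simp: adom_def)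
qed

lemma relsym_conj_image: "relsym ` conj_image h \<alpha> = relsym ` set \<alpha>"
  by (force simp: conj_image_def image_iff atom.map_sel)

text \<open>Universal variables of the head are frontier variables, where \<open>h\<close> and
  \<open>g\<close> agree. So the witness \<open>g'\<close>, overwritten by \<open>h\<close> on the
  universal variables, has the same head image.\<close>

lemma not_active_if_equiv:
  assumes "trigger_equiv (\<xi>, h) (\<xi>, g)" "extends \<xi> g g'" "conj_image g' (head \<xi>) \<subseteq> I"
  shows "\<not> active I (\<xi>, h)"
proof -
  define h' where "h' x = (if x \<in> universal_vars \<xi> then h x else g' x)" for x
  have "h' x = g' x" if "x \<in> conj_vars (head \<xi>)" for x
    using that assms(1,2)
    by (auto simp: h'_def trigger_equiv_def extends_def frontier_def universal_vars_def)
  then have "conj_image h' (head \<xi>) \<subseteq> I"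
    using assms(3) conj_image_cong by metis
  moreover have "extends \<xi> h h'"
    by (simp add: extends_def h'_def)
  ultimately show ?thesis
    by (auto simp: active_def)
qed

lemma finite_chase_terminates:
  "chase_sequence v \<Sigma> I0 (enat n) I T \<Longrightarrow> terminates v \<Sigma> (enat n) I T"
  by (auto simp: chase_sequence_def terminates_def)

section \<open>The simulating standard chase\<close>

locale infinite_sobl_chase =
  fixes \<Sigma> :: "tgd set" and H :: "tgd \<Rightarrow> relsym" and X :: "tgd \<Rightarrow> nat list"
    and I :: "nat \<Rightarrow> inst" and T :: "nat \<Rightarrow> trigger"
  assumes inj_H: "inj_on H \<Sigma>"
    and set_X: "\<xi> \<in> \<Sigma> \<Longrightarrow> set (X \<xi>) = frontier \<xi>"
    and H_new: "\<xi> \<in> \<Sigma> \<Longrightarrow> H \<xi> \<notin> schema_of \<Sigma>"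
    and applicable_T: "applicable_at Sobl \<Sigma> I T i (T i)"
    and fire_T: "fire (T i) (I i) (I (Suc i))"
    and fair_T: "fair Sobl \<Sigma> I T"
begin

definition E :: "tgd \<Rightarrow> tgd" where
  "E \<xi> = enrich (H \<xi>) (X \<xi>) \<xi>"

text \<open>The \<open>H\<close>-atom that the enriched tgd adds. Only frontier values enter it, so
  it is constant on equivalence classes.\<close>

definition marker :: "trigger \<Rightarrow> val atom" where
  "marker t = Atom (H (fst t)) (map (snd t) (X (fst t)))"

text \<open>Filtering each \<open>I i\<close> amounts to filtering \<open>I 0\<close> alone, since
  fired heads stay within the schema.\<close>

definition I' :: "nat \<Rightarrow> inst" where
  "I' i = {a \<in> I i. relsym a \<in> schema_of \<Sigma>} \<union> marker ` T ` {..<i}"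

definition T' :: "nat \<Rightarrow> trigger" where
  "T' i = (E (fst (T i)), snd (T i))"

lemma trigger_T: "is_trigger \<Sigma> (I i) (T i)"
  using applicable_T[of i] by (simp add: applicable_at_def)

lemma tgd_T: "fst (T i) \<in> \<Sigma>"
  using trigger_T[of i] by (auto simp: is_trigger_def)

lemma mono_I: "i \<le> j \<Longrightarrow> I i \<subseteq> I j"
proof (rule lift_Suc_mono_le)
  show "I n \<subseteq> I (Suc n)" for n
    using fire_T[of n] by (auto simp: fire_def split: prod.splits)
qed

lemma relsym_subset_schema:
  assumes "\<xi> \<in> \<Sigma>"
  shows "relsym ` set (body \<xi>) \<subseteq> schema_of \<Sigma>" "relsym ` set (head \<xi>) \<subseteq> schema_of \<Sigma>"
  using assms by (auto simp: schema_of_def)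

text \<open>Markers carry new symbols, so \<open>I' i\<close> and \<open>I i\<close> have the same
  atoms over the schema.\<close>

lemma conj_image_subset_I'_iff:
  assumes "relsym ` set \<alpha> \<subseteq> schema_of \<Sigma>"
  shows "conj_image h \<alpha> \<subseteq> I' i \<longleftrightarrow> conj_image h \<alpha> \<subseteq> I i"
proof -
  have "relsym a \<in> schema_of \<Sigma>" if "a \<in> conj_image h \<alpha>" for a
    using that assms relsym_conj_image[of h \<alpha>] by blast
  moreover have "relsym a \<notin> schema_of \<Sigma>" if "a \<in> marker ` T ` {..<i}" for a
    using that H_new tgd_T by (auto simp: marker_def)
  ultimately show ?thesis
    unfolding I'_def by blast
qed

section \<open>Applicability in the two chases\<close>

lemma is_trigger_E_iff:
  "\<xi> \<in> \<Sigma> \<Longrightarrow> is_trigger (E ` \<Sigma>) (I' i) (E \<xi>, h) \<longleftrightarrow> is_trigger \<Sigma> (I i) (\<xi>, h)"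
  by (auto simp: is_trigger_def E_def conj_image_subset_I'_iff relsym_subset_schema)

text \<open>Injectivity of \<open>H\<close> recovers the tgd from the symbol; the arguments then
  recover the frontier values.\<close>

lemma marker_eq_imp_equiv:
  assumes "\<xi> \<in> \<Sigma>" "marker (\<xi>, h) = marker (T j)"
  shows "trigger_equiv (\<xi>, h) (T j)"
proof -
  obtain \<zeta> g where T: "T j = (\<zeta>, g)" by fastforce
  have "\<xi> = \<zeta>"
    using assms T tgd_T[of j] inj_H by (auto simp: marker_def dest: inj_onD)
  with assms T show ?thesis
    using set_X by (auto simp: marker_def trigger_equiv_def)
qed

text \<open>The filtered part contains no \<open>H\<close>-atoms, so a marker in \<open>I' i\<close>
  stems from a fired trigger.\<close>

lemma marker_mem_I':
  assumes "\<xi> \<in> \<Sigma>" "marker (\<xi>, h) \<in> I' i"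
  obtains j where "j < i" "trigger_equiv (\<xi>, h) (T j)"
  using assms H_new marker_eq_imp_equiv by (fastforce simp: I'_def marker_def)

lemma marker_extends:
  assumes "\<xi> \<in> \<Sigma>" "extends \<xi> h h'"
  shows "Atom (H \<xi>) (map h' (X \<xi>)) = marker (\<xi>, h)"
  using assms set_X frontier_subset_universal_vars[of \<xi>]
  by (auto simp: marker_def extends_def)

lemma fired_head:
  assumes "T j = (\<xi>, g)" "j < i"
  obtains g' where "extends \<xi> g g'" "conj_image g' (head (E \<xi>)) \<subseteq> I' i"
proof -
  have \<xi>: "\<xi> \<in> \<Sigma>"
    using tgd_T[of j] assms by simp
  obtain g' where g': "extends \<xi> g g'" "conj_image g' (head \<xi>) \<subseteq> I (Suc j)"
    using fire_T[of j] assms by (auto simp: fire_def)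
  then have "conj_image g' (head \<xi>) \<subseteq> I' i"
    using mono_I[of "Suc j" i] assms \<xi> by (auto simp: conj_image_subset_I'_iff relsym_subset_schema)
  moreover have "marker (\<xi>, g) \<in> I' i"
    using assms by (force simp: I'_def image_iff)
  ultimately show thesis
    using that g'(1) marker_extends[OF \<xi> g'(1)] by (simp add: E_def conj_image_head_enrich)
qed

lemma active_E_iff:
  assumes "\<xi> \<in> \<Sigma>"
  shows "active (I' i) (E \<xi>, h) \<longleftrightarrow> (\<forall>j<i. \<not> trigger_equiv (\<xi>, h) (T j))"
proof
  assume act: "active (I' i) (E \<xi>, h)"
  show "\<forall>j<i. \<not> trigger_equiv (\<xi>, h) (T j)"
  proof (intro allI impI notI)
    fix j assume j: "j < i" "trigger_equiv (\<xi>, h) (T j)"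
    then obtain g where T: "T j = (\<xi>, g)"
      by (cases "T j") (auto simp: trigger_equiv_def)
    obtain g' where g': "extends \<xi> g g'" "conj_image g' (head (E \<xi>)) \<subseteq> I' i"
      using fired_head[OF T j(1)] .
    \<comment> \<open>The added atom mentions frontier variables only, so equivalence passes to the
      enriched tgd.\<close>
    have "frontier (E \<xi>) = frontier \<xi>"
      using set_X[OF assms] by (auto simp: E_def frontier_def enrich_def conj_vars_def)
    then have "trigger_equiv (E \<xi>, h) (E \<xi>, g)"
      using j(2) T by (simp add: trigger_equiv_def)
    then show False
      using not_active_if_equiv g' act by (metis E_def extends_enrich)
  qed
next
  assume unfired: "\<forall>j<i. \<not> trigger_equiv (\<xi>, h) (T j)"
  show "active (I' i) (E \<xi>, h)"
    unfolding active_def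
  proof clarsimp
    \<comment> \<open>Any witness for the enriched head also yields its \<open>H\<close>-atom, which
      is the marker because extensions agree with \<open>h\<close> on the frontier.\<close>
    fix h' assume "extends (E \<xi>) h h'" "conj_image h' (head (E \<xi>)) \<subseteq> I' i"
    then have "marker (\<xi>, h) \<in> I' i"
      using marker_extends[OF assms, of h h'] by (simp add: E_def conj_image_head_enrich)
    then show False
      using marker_mem_I'[OF assms] unfired by blast
  qed
qed

lemma applicable_at_E_iff:
  "\<xi> \<in> \<Sigma> \<Longrightarrow> applicable_at Std (E ` \<Sigma>) I' T' i (E \<xi>, h) \<longleftrightarrow> applicable_at Sobl \<Sigma> I T i (\<xi>, h)"
  by (auto simp: applicable_at_def is_trigger_E_iff active_E_iff)

lemma applicable_T': "applicable_at Std (E ` \<Sigma>) I' T' i (T' i)"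
  using applicable_at_E_iff[OF tgd_T, of i i "snd (T i)"] applicable_T[of i] by (simp add: T'_def)

section \<open>Fairness, freshness and nontermination of the simulation\<close>

lemma fair_T': "fair Std (E ` \<Sigma>) I' T'"
  unfolding fair_def
proof (intro allI impI)
  fix i t assume app: "applicable_at Std (E ` \<Sigma>) I' T' i t"
  then obtain \<xi> h where t: "t = (E \<xi>, h)" "\<xi> \<in> \<Sigma>"
    by (cases t) (auto simp: applicable_at_def is_trigger_def)
  with app have "applicable_at Sobl \<Sigma> I T i (\<xi>, h)"
    by (simp add: applicable_at_E_iff)
  then obtain j where "j \<ge> i" "T j = (\<xi>, h) \<or> \<not> applicable_at Sobl \<Sigma> I T j (\<xi>, h)"
    using fair_T unfolding fair_def by blast
  then show "\<exists>j\<ge>i. T' j = t \<or> \<not> applicable_at Std (E ` \<Sigma>) I' T' j t"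
    using t by (auto simp: applicable_at_E_iff T'_def)
qed

text \<open>Nulls fresh for \<open>I i\<close> are thereby fresh for \<open>I' i\<close>. Marker
  arguments are frontier values, which already occur in the body image of the fired trigger.\<close>

lemma adom_I'_subset: "adom (I' i) \<subseteq> adom (I i)"
proof -
  have "set (args (marker (T j))) \<subseteq> adom (I i)" if "j < i" for j
  proof -
    obtain \<xi> h where T: "T j = (\<xi>, h)" by fastforce
    have "conj_image h (body \<xi>) \<subseteq> I i"
      using trigger_T[of j] mono_I[of j i] that T by (auto simp: is_trigger_def)
    then have "h ` conj_vars (body \<xi>) \<subseteq> adom (I i)"
      by (rule image_conj_vars_subset_adom)
    then show ?thesis
      using T tgd_T[of j] set_X by (auto simp: marker_def frontier_def)
  qed
  then show ?thesis
    by (fastforce simp: I'_def adom_def)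
qed

lemma fire_T': "fire (T' i) (I' i) (I' (Suc i))"
proof -
  obtain \<xi> h where T: "T i = (\<xi>, h)" by fastforce
  then have \<xi>: "\<xi> \<in> \<Sigma>"
    using tgd_T[of i] by simp
  obtain h' where h': "extends \<xi> h h'" "inj_on h' (existential_vars \<xi>)"
    "h' ` existential_vars \<xi> \<subseteq> range Null - adom (I i)" "I (Suc i) = I i \<union> conj_image h' (head \<xi>)"
    using fire_T[of i] T by (auto simp: fire_def)
  \<comment> \<open>The fired head survives the filter, so \<open>I'\<close> grows by exactly this
    head and the new marker.\<close>
  have "relsym a \<in> schema_of \<Sigma>" if "a \<in> conj_image h' (head \<xi>)" for a
    using that relsym_subset_schema(2)[OF \<xi>] relsym_conj_image[of h' "head \<xi>"] by blast
  then have "I' (Suc i) = I' i \<union> insert (marker (\<xi>, h)) (conj_image h' (head \<xi>))"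
    using h'(4) T by (auto simp: I'_def lessThan_Suc)
  then have "I' (Suc i) = I' i \<union> conj_image h' (head (E \<xi>))"
    using marker_extends[OF \<xi> h'(1)] by (simp add: E_def conj_image_head_enrich)
  moreover have "existential_vars (E \<xi>) = existential_vars \<xi>"
    unfolding E_def
    by (intro existential_vars_enrich) (simp add: set_X \<xi> frontier_subset_universal_vars)
  moreover have "extends (E \<xi>) h h'"
    using h'(1) by (simp add: E_def)
  ultimately show ?thesis
    using h'(2,3) adom_I'_subset[of i] by (auto simp: fire_def T'_def T intro!: exI[of _ h'])
qed

lemma enriched_not_in_CT_Std:
  assumes "is_instance (I 0)"
  shows "E ` \<Sigma> \<notin> CT Std"
proof
  assume "E ` \<Sigma> \<in> CT Std"
  \<comment> \<open>Nothing has been fired yet, so \<open>I' 0\<close> has no markers and is a part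
    of \<open>I 0\<close>.\<close>
  moreover have "is_instance (I' 0)"
    using assms by (auto simp: is_instance_def I'_def)
  moreover have "chase_sequence Std (E ` \<Sigma>) (I' 0) \<infinity> I' T'"
    by (simp add: chase_sequence_def applicable_T' fire_T' fair_T')
  ultimately have "terminates Std (E ` \<Sigma>) \<infinity> I' T'"
    by (auto simp: CT_def)
  then show False
    using applicable_T' unfolding terminates_def by blast
qed

end

section \<open>From the simulation to the class\<close>

theorem proposition5:
  fixes \<C> :: "tgd set set"
  assumes "\<forall>\<Sigma>\<in>\<C>. tgd_set \<Sigma>"
    and "\<C> \<subseteq> CT Std"
    and "closed_under_semi_enrichment \<C>"
  shows "\<C> \<subseteq> CT Sobl"
proof
  fix \<Sigma> assume \<Sigma>: "\<Sigma> \<in> \<C>"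
  have "terminates Sobl \<Sigma> N I T"
    if I0: "is_instance I0" and chase: "chase_sequence Sobl \<Sigma> I0 N I T" for I0 N I T
  proof (cases N)
    case (enat n)
    then show ?thesis
      using chase finite_chase_terminates by blast
  next
    case infinity
    obtain \<Sigma>' where \<Sigma>': "\<Sigma>' \<in> \<C>" "semi_enrichment \<Sigma> \<Sigma>'"
      using assms(3) \<Sigma> by (auto simp: closed_under_semi_enrichment_def)
    obtain H X where H: "inj_on H \<Sigma>"
      "\<forall>\<xi>\<in>\<Sigma>. set (X \<xi>) = frontier \<xi> \<and> H \<xi> \<notin> schema_of \<Sigma>"
      "\<Sigma>' = (\<lambda>\<xi>. enrich (H \<xi>) (X \<xi>) \<xi>) ` \<Sigma>"
      using \<Sigma>'(2) by (force simp: semi_enrichment_def)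
    \<comment> \<open>With \<open>N = \<infinity>\<close> the guard \<open>enat i < N\<close> holds
      at every index.\<close>
    interpret infinite_sobl_chase \<Sigma> H X I T
      using H chase infinity by unfold_locales (auto simp: chase_sequence_def)
    have "E ` \<Sigma> = \<Sigma>'"
      by (simp add: H(3) E_def)
    moreover have "is_instance (I 0)"
      using I0 chase by (simp add: chase_sequence_def)
    \<comment> \<open>The simulation contradicts \<open>\<C> \<subseteq> CT Std\<close>, so the
      infinite case cannot occur.\<close>
    ultimately show ?thesis
      using enriched_not_in_CT_Std \<Sigma>'(1) assms(2) by blast
  qed
  then show "\<Sigma> \<in> CT Sobl"
    using assms(1) \<Sigma> by (auto simp: CT_def)
qed

end
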